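(* Let $\mu$ be a finitely supported symmetric probability distribution on an amenable (discrete) group $G$. Then every order-bounded $G$-representation on any non-singular ordered vector space admits a $\mu$-stationary vector pricing.
   Context: $\mu$ is symmetric if $\mu(g)=\mu(g^{-1})$ for all $g\in G$. An ordered vector space is a real vector space $V$ with a partial order compatible with addition and with multiplication by positive scalars; $V^+=\{v\in V:v\geq 0\}$. $V$ is non-singular if for every $v\in V^+$, $v\neq 0$, there is a positive linear functional on $V$ that is non-zero on $v$. A $G$-representation on $V$ is an action of $G$ by positive linear maps (mapping $V^+$ into $V^+$); it is order-bounded if every $G$-orbit admits some upper bound in $V$. Write $\mu*v=\sum_{g\in G}\mu(g)\,gv$ for $v\in V$. A vector pricing on $V$ is a map $r\colon V^+\times V^+\to[0,+\infty]$ such that for all $u,v,w\in V^+$: (VP1) $r(u+v,w)=r(u,w)+r(v,w)$ when $w\neq 0$; (VP2) $r(u,w)=r(u,v)\,r(v,w)$ when defined (only the product of $0$ and $+\infty$ is undefined); (VP3) $r(u,u)=1$. It is $\mu$-stationary if $r(\mu*u,v)=r(u,v)$ for all $u,v\in V^+$. *)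

theory Defs
  imports "HOL-Algebra.Group_Action" "HOL-Probability.Probability_Mass_Function"
begin

text \<open>
  Amenability of a discrete group: there is a left-invariant mean on the bounded real functions.
  The mean is applied to functions on the whole type; positivity forces it to depend only on
  the values on the carrier.
\<close>

definition invariant_mean :: "('g, 'm) monoid_scheme \<Rightarrow> (('g \<Rightarrow> real) \<Rightarrow> real) \<Rightarrow> bool" where
  "invariant_mean G m \<longleftrightarrow>
     (\<forall>f h. bounded (f ` carrier G) \<longrightarrow> bounded (h ` carrier G) \<longrightarrow>
        m (\<lambda>x. f x + h x) = m f + m h) \<and>
     (\<forall>c f. bounded (f ` carrier G) \<longrightarrow> m (\<lambda>x. c * f x) = c * m f) \<and>
     (\<forall>f. bounded (f ` carrier G) \<longrightarrow> (\<forall>x\<in>carrier G. 0 \<le> f x) \<longrightarrow> 0 \<le> m f) \<and>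
     m (\<lambda>x. 1) = 1 \<and>
     (\<forall>g\<in>carrier G. \<forall>f. bounded (f ` carrier G) \<longrightarrow> m (\<lambda>x. f (g \<otimes>\<^bsub>G\<^esub> x)) = m f)"

definition amenable_group :: "('g, 'm) monoid_scheme \<Rightarrow> bool" where
  "amenable_group G \<longleftrightarrow> group G \<and> (\<exists>m. invariant_mean G m)"

definition finitely_supported_distribution_on ::
    "('g, 'm) monoid_scheme \<Rightarrow> 'g pmf \<Rightarrow> bool" where
  "finitely_supported_distribution_on G \<mu> \<longleftrightarrow> finite (set_pmf \<mu>) \<and> set_pmf \<mu> \<subseteq> carrier G"

definition symmetric_distribution :: "('g, 'm) monoid_scheme \<Rightarrow> 'g pmf \<Rightarrow> bool" where
  "symmetric_distribution G \<mu> \<longleftrightarrow> (\<forall>g\<in>carrier G. pmf \<mu> g = pmf \<mu> (inv\<^bsub>G\<^esub> g))"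

text \<open>
  Ordered vector spaces are types of class \<^class>\<open>ordered_real_vector\<close>; the positive cone
  is the set \<open>{0..}\<close>.
\<close>

definition positive_map :: "('v::ordered_real_vector \<Rightarrow> 'w::ordered_real_vector) \<Rightarrow> bool" where
  "positive_map T \<longleftrightarrow> linear T \<and> (\<forall>v\<in>{0..}. T v \<in> {0..})"

definition non_singular :: "'v::ordered_real_vector itself \<Rightarrow> bool" where
  "non_singular V \<longleftrightarrow>
     (\<forall>v::'v. v \<in> {0..} \<longrightarrow> v \<noteq> 0 \<longrightarrow> (\<exists>f::'v \<Rightarrow> real. positive_map f \<and> f v \<noteq> 0))"

definition ordered_representation ::
    "('g, 'm) monoid_scheme \<Rightarrow> ('g \<Rightarrow> 'v::ordered_real_vector \<Rightarrow> 'v) \<Rightarrow> bool" where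
  "ordered_representation G \<phi> \<longleftrightarrow>
     group_action G UNIV \<phi> \<and> (\<forall>g\<in>carrier G. positive_map (\<phi> g))"

definition order_bounded ::
    "('g, 'm) monoid_scheme \<Rightarrow> ('g \<Rightarrow> 'v::ordered_real_vector \<Rightarrow> 'v) \<Rightarrow> bool" where
  "order_bounded G \<phi> \<longleftrightarrow> (\<forall>v. bdd_above (orbit G \<phi> v))"

definition convolve ::
    "('g \<Rightarrow> 'v::ordered_real_vector \<Rightarrow> 'v) \<Rightarrow> 'g pmf \<Rightarrow> 'v \<Rightarrow> 'v" where
  "convolve \<phi> \<mu> v = (\<Sum>g\<in>set_pmf \<mu>. pmf \<mu> g *\<^sub>R \<phi> g v)"

text \<open>
  In \<^typ>\<open>ennreal\<close> the product of \<open>0\<close> and \<open>\<infinity>\<close> is \<open>0\<close>, so the multiplicativity axiom has to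
  exclude that product explicitly.
\<close>

definition product_defined :: "ennreal \<Rightarrow> ennreal \<Rightarrow> bool" where
  "product_defined a b \<longleftrightarrow> \<not> (a = 0 \<and> b = \<infinity>) \<and> \<not> (a = \<infinity> \<and> b = 0)"

text \<open>Values of a pricing outside the positive cone are irrelevant.\<close>

definition vector_pricing :: "('v::ordered_real_vector \<Rightarrow> 'v \<Rightarrow> ennreal) \<Rightarrow> bool" where
  "vector_pricing r \<longleftrightarrow>
     (\<forall>u\<in>{0..}. \<forall>v\<in>{0..}. \<forall>w\<in>{0..}. w \<noteq> 0 \<longrightarrow> r (u + v) w = r u w + r v w) \<and>
     (\<forall>u\<in>{0..}. \<forall>v\<in>{0..}. \<forall>w\<in>{0..}.
        product_defined (r u v) (r v w) \<longrightarrow> r u w = r u v * r v w) \<and>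
     (\<forall>u\<in>{0..}. r u u = 1)"

definition stationary_pricing ::
    "('g \<Rightarrow> 'v::ordered_real_vector \<Rightarrow> 'v) \<Rightarrow> 'g pmf \<Rightarrow> ('v \<Rightarrow> 'v \<Rightarrow> ennreal) \<Rightarrow> bool" where
  "stationary_pricing \<phi> \<mu> r \<longleftrightarrow> (\<forall>u\<in>{0..}. \<forall>v\<in>{0..}. r (convolve \<phi> \<mu> u) v = r u v)"

end

theory Submission imports Defs "HOL-Algebra.Generated_Groups" "HOL-Analysis.Function_Topology" begin

text \<open>
  A pricing arises as a limit of ratios \<open>f u / f v\<close> of positive functionals, by compactness of
  \<open>[0, \<infinity>]\<close>-valued functions; so it suffices to find, for finitely many positive vectors, a
  functional that is positive and almost \<open>\<mu>\<close>-stationary on them up to a factor \<open>l > 1\<close>.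
  With \<open>P v = \<mu> * v\<close>, such a functional is \<open>\<Sum>n. a n * f0 (P ^^ n v)\<close> for suitable slowly varying
  weights \<open>a\<close>, provided that \<open>\<Sum>n. l ^ n * f0 (P ^^ n v)\<close> diverges for all \<open>l > 1\<close>.  This is
  the easy half of Kesten's theorem: otherwise a positive \<open>u\<close> with \<open>l * (\<mu> * u) \<le> u\<close> exists, and
  the invariant mean of the \<open>\<mu>\<close>-average of its logarithmic increments would be both zero and at
  least \<open>ln l\<close>.
\<close>

section \<open>Invariant means on bounded functions\<close>

lemma invariant_mean_sum:
  assumes "invariant_mean G m" "finite S" "\<And>s. s \<in> S \<Longrightarrow> bounded (F s ` carrier G)"
  shows "bounded ((\<lambda>x. \<Sum>s\<in>S. F s x) ` carrier G) \<and>
         m (\<lambda>x. \<Sum>s\<in>S. F s x) = (\<Sum>s\<in>S. m (F s))"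
  using assms(2,3)
proof (induction S rule: finite_induct)
  case empty
  have "bounded ((\<lambda>x. 1::real) ` carrier G)"
    by (simp add: image_constant_conv)
  then have "m (\<lambda>x. 0 * 1) = 0 * m (\<lambda>x. 1)"
    using assms(1) unfolding invariant_mean_def by blast
  moreover have "bounded ((\<lambda>x. 0::real) ` carrier G)"
    by (simp add: image_constant_conv)
  ultimately show ?case by simp
next
  case (insert s S)
  then have b: "bounded (F s ` carrier G)" "bounded ((\<lambda>x. \<Sum>s\<in>S. F s x) ` carrier G)"
    and e: "m (\<lambda>x. \<Sum>s\<in>S. F s x) = (\<Sum>s\<in>S. m (F s))" by auto
  have "m (\<lambda>x. F s x + (\<Sum>s\<in>S. F s x)) = m (F s) + m (\<lambda>x. \<Sum>s\<in>S. F s x)"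
    using assms(1) b unfolding invariant_mean_def by blast
  moreover have "bounded ((\<lambda>x. F s x + (\<Sum>s\<in>S. F s x)) ` carrier G)"
    using b by (rule bounded_plus_comp)
  ultimately show ?case using insert.hyps e by simp
qed

lemma invariant_mean_mono:
  assumes m: "invariant_mean G m"
    and b: "bounded (f ` carrier G)" "bounded (h ` carrier G)"
    and le: "\<And>x. x \<in> carrier G \<Longrightarrow> f x \<le> h x"
  shows "m f \<le> m h"
proof -
  have b': "bounded ((\<lambda>x. (-1) * f x) ` carrier G)"
    using b(1) by (simp add: bounded_minus_comp)
  have "0 \<le> m (\<lambda>x. h x + (-1) * f x)"
    using m bounded_plus_comp[OF b(2) b'] le unfolding invariant_mean_def by simp
  also have "\<dots> = m h + (-1) * m f"
    using m b b' unfolding invariant_mean_def by metis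
  finally show ?thesis by simp
qed

section \<open>Superharmonic functions on amenable groups\<close>

lemma symmetric_inv_mem:
  assumes "symmetric_distribution G \<mu>" "set_pmf \<mu> \<subseteq> carrier G" "s \<in> set_pmf \<mu>"
  shows "inv\<^bsub>G\<^esub> s \<in> set_pmf \<mu>"
  using assms unfolding symmetric_distribution_def by (metis in_mono pmf_eq_0_set_pmf)

lemma sum_pmf_support:
  "finite (set_pmf \<mu>) \<Longrightarrow> (\<Sum>s\<in>set_pmf \<mu>. pmf \<mu> s) = 1"
  by (simp add: sum_pmf_eq_1)

text \<open>
  Harnack's inequality makes the logarithmic increments of \<open>u\<close> bounded, although \<open>ln u\<close> itself
  need not be.
\<close>

lemma amenable_no_strict_superharmonic:
  fixes G :: "('g, 'm) monoid_scheme" (structure) and u :: "'g \<Rightarrow> real"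
  assumes am: "amenable_group G"
    and fs: "finitely_supported_distribution_on G \<mu>"
    and sym: "symmetric_distribution G \<mu>"
    and pos: "\<And>x. x \<in> carrier G \<Longrightarrow> 0 < u x"
    and l: "0 < l"
    and sup: "\<And>x. x \<in> carrier G \<Longrightarrow> l * (\<Sum>s\<in>set_pmf \<mu>. pmf \<mu> s * u (inv\<^bsub>G\<^esub> s \<otimes>\<^bsub>G\<^esub> x)) \<le> u x"
  shows "l \<le> 1"
proof -
  interpret group G using am unfolding amenable_group_def by simp
  obtain m where m: "invariant_mean G m" using am unfolding amenable_group_def by blast
  note mD = m[unfolded invariant_mean_def]
  let ?S = "set_pmf \<mu>"
  have fin: "finite ?S" and SG: "?S \<subseteq> carrier G"
    using fs unfolding finitely_supported_distribution_on_def by auto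
  have inS: "inv s \<in> ?S" if "s \<in> ?S" for s
    using symmetric_inv_mem[OF sym SG that] .
  have sinv: "pmf \<mu> (inv s) = pmf \<mu> s" if "s \<in> ?S" for s
    using sym SG that unfolding symmetric_distribution_def by (metis subsetD)
  have harnack: "l * pmf \<mu> s * u (inv s \<otimes> x) \<le> u x" if "s \<in> ?S" "x \<in> carrier G" for s x
  proof -
    have "pmf \<mu> s * u (inv s \<otimes> x) \<le> (\<Sum>s\<in>?S. pmf \<mu> s * u (inv s \<otimes> x))"
      using that fin SG
      by (intro member_le_sum) (auto intro!: mult_nonneg_nonneg less_imp_le[OF pos])
    then have "l * (pmf \<mu> s * u (inv s \<otimes> x)) \<le> l * (\<Sum>s\<in>?S. pmf \<mu> s * u (inv s \<otimes> x))"
      using l by (intro mult_left_mono) auto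
    then show ?thesis using sup[OF that(2)] by (simp add: mult.assoc)
  qed
  define F where "F s x = ln (u x) - ln (u (inv s \<otimes> x))" for s x
  have lower: "ln (l * pmf \<mu> s) \<le> F s x" if "s \<in> ?S" "x \<in> carrier G" for s x
  proof -
    have p: "0 < u (inv s \<otimes> x)" "0 < u x" "0 < l * pmf \<mu> s"
      using that SG pos l by (auto simp: pmf_positive)
    then have "ln (l * pmf \<mu> s * u (inv s \<otimes> x)) \<le> ln (u x)"
      using harnack[OF that] by (metis ln_mono mult_pos_pos)
    moreover have "ln (l * pmf \<mu> s * u (inv s \<otimes> x)) = ln (l * pmf \<mu> s) + ln (u (inv s \<otimes> x))"
      using p by (intro ln_mult_pos) auto
    ultimately show ?thesis unfolding F_def by linarith
  qed
  have anti: "F s x = - F (inv s) (inv s \<otimes> x)" if "s \<in> ?S" "x \<in> carrier G" for s x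
  proof -
    have "s \<in> carrier G" using that SG by blast
    then have "inv (inv s) \<otimes> (inv s \<otimes> x) = x" using that(2) by (simp flip: m_assoc)
    then show ?thesis unfolding F_def by simp
  qed
  \<comment> \<open>\<open>lower\<close> for \<open>s\<close> bounds the increment from below; by
    \<open>anti\<close>, \<open>lower\<close> for \<open>inv s\<close> at the shifted point bounds
    it from above. Symmetry of \<open>\<mu>\<close> makes the two constants opposite.\<close>
  have bdd: "bounded (F s ` carrier G)" if s: "s \<in> ?S" for s
  proof -
    have sG: "inv s \<otimes> x \<in> carrier G" if "x \<in> carrier G" for x
      using that s SG by blast
    have "\<bar>F s x\<bar> \<le> \<bar>ln (l * pmf \<mu> s)\<bar>" if x: "x \<in> carrier G" for x
      using lower[OF s x] anti[OF s x] lower[OF inS[OF s] sG[OF x], unfolded sinv[OF s]]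
      by linarith
    then show ?thesis unfolding bounded_iff by auto
  qed
  have bddc: "bounded ((\<lambda>x. c * F s x) ` carrier G)" if "s \<in> ?S" for s c
    using bounded_scaling[OF bdd[OF that], of c] by (simp add: image_image)
  have const: "m (\<lambda>x. c) = c" for c
  proof -
    have "bounded ((\<lambda>x. 1::real) ` carrier G)"
      by (simp add: image_constant_conv)
    then have "m (\<lambda>x. c * 1) = c * m (\<lambda>x. 1)" using mD by blast
    then show ?thesis using mD by simp
  qed
  \<comment> \<open>Left invariance of the mean absorbs the shift in \<open>anti\<close> and leaves
    only the change of sign.\<close>
  have manti: "m (F s) = - m (F (inv s))" if s: "s \<in> ?S" for s
  proof -
    let ?h = "\<lambda>x. F (inv s) (inv s \<otimes> x)"
    have bh: "bounded (?h ` carrier G)"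
    proof (rule bounded_subset[OF bdd[OF inS[OF s]]])
      show "?h ` carrier G \<subseteq> F (inv s) ` carrier G" using s SG by blast
    qed
    have b': "bounded ((\<lambda>x. (-1) * ?h x) ` carrier G)"
      using bh by (simp add: bounded_minus_comp)
    have e: "F s x = (-1) * ?h x" if "x \<in> carrier G" for x
      using anti[OF s that] by linarith
    \<comment> \<open>The two functions are known to agree on the carrier only, so their means are
      compared by monotonicity in both directions.\<close>
    have "m (F s) = m (\<lambda>x. (-1) * ?h x)"
    proof (rule antisym)
      show "m (F s) \<le> m (\<lambda>x. (-1) * ?h x)"
        by (rule invariant_mean_mono[OF m bdd[OF s] b']) (rule eq_refl[OF e])
      show "m (\<lambda>x. (-1) * ?h x) \<le> m (F s)"
        by (rule invariant_mean_mono[OF m b' bdd[OF s]]) (rule eq_refl[OF e[symmetric]])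
    qed
    also have "\<dots> = (-1) * m ?h" using mD bh by blast
    also have "m ?h = m (F (inv s))"
      using mD bdd[OF inS[OF s]] s SG by (meson inv_closed subsetD)
    finally show ?thesis by simp
  qed
  \<comment> \<open>The substitution of \<open>inv s\<close> for \<open>s\<close> preserves the
    weights and reverses the means, so this total equals its own negative.\<close>
  let ?T = "\<Sum>s\<in>?S. pmf \<mu> s * m (F s)"
  have "?T = (\<Sum>s\<in>?S. pmf \<mu> (inv s) * m (F (inv s)))"
    by (rule sum.reindex_bij_witness[of _ "\<lambda>s. inv s" "\<lambda>s. inv s"]) (use inS SG in auto)
  also have "\<dots> = (\<Sum>s\<in>?S. - (pmf \<mu> s * m (F s)))"
  proof (rule sum.cong[OF refl])
    fix s assume s: "s \<in> ?S"
    show "pmf \<mu> (inv s) * m (F (inv s)) = - (pmf \<mu> s * m (F s))"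
      unfolding sinv[OF s] manti[OF s] by simp
  qed
  also have "\<dots> = - ?T" by (rule sum_negf)
  finally have T0: "?T = 0" by simp
  \<comment> \<open>Jensen's inequality for \<open>ln\<close>: the tangent bound
    \<open>ln y \<le> y - 1\<close> at \<open>y = l * u (inv s \<otimes> x) / u x\<close>, averaged
    over \<open>\<mu>\<close>, has a nonpositive right side by \<open>sup\<close>.\<close>
  have ge: "ln l \<le> (\<Sum>s\<in>?S. pmf \<mu> s * F s x)" if x: "x \<in> carrier G" for x
  proof -
    have "pmf \<mu> s * (ln l - F s x) \<le> pmf \<mu> s * (l * u (inv s \<otimes> x) / u x - 1)" if s: "s \<in> ?S" for s
    proof -
      have p: "0 < u (inv s \<otimes> x)" "0 < u x" using s x SG pos by auto
      have "ln l - F s x = ln (l * u (inv s \<otimes> x) / u x)"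
        using p l unfolding F_def by (simp add: ln_mult_pos ln_div)
      also have "\<dots> \<le> l * u (inv s \<otimes> x) / u x - 1"
        using p l by (intro ln_le_minus_one) auto
      finally show ?thesis by (simp add: mult_left_mono)
    qed
    then have "(\<Sum>s\<in>?S. pmf \<mu> s * (ln l - F s x))
        \<le> (\<Sum>s\<in>?S. pmf \<mu> s * (l * u (inv s \<otimes> x) / u x - 1))"
      by (rule sum_mono)
    also have "\<dots> = l * (\<Sum>s\<in>?S. pmf \<mu> s * u (inv s \<otimes> x)) / u x - 1"
      using sum_pmf_support[OF fin]
      by (simp add: right_diff_distrib sum_subtractf sum_distrib_left sum_divide_distrib mult_ac)
    also have "\<dots> \<le> 0" using sup[OF x] pos[OF x] by simp
    finally show ?thesis
      using sum_pmf_support[OF fin]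
      by (simp add: right_diff_distrib sum_subtractf sum_distrib_right[symmetric])
  qed
  have "bounded ((\<lambda>x. \<Sum>s\<in>?S. pmf \<mu> s * F s x) ` carrier G) \<and>
      m (\<lambda>x. \<Sum>s\<in>?S. pmf \<mu> s * F s x) = (\<Sum>s\<in>?S. m (\<lambda>x. pmf \<mu> s * F s x))"
    by (rule invariant_mean_sum[OF m fin]) (rule bddc)
  also have "(\<Sum>s\<in>?S. m (\<lambda>x. pmf \<mu> s * F s x)) = ?T"
    by (rule sum.cong[OF refl]) (use mD bdd in blast)
  finally have M: "bounded ((\<lambda>x. \<Sum>s\<in>?S. pmf \<mu> s * F s x) ` carrier G)"
      "m (\<lambda>x. \<Sum>s\<in>?S. pmf \<mu> s * F s x) = 0" using T0 by auto
  have cb: "bounded ((\<lambda>x. ln l) ` carrier G)" by (simp add: image_constant_conv)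
  have "m (\<lambda>x. ln l) \<le> m (\<lambda>x. \<Sum>s\<in>?S. pmf \<mu> s * F s x)"
    by (rule invariant_mean_mono[OF m cb M(1) ge])
  then show ?thesis using l by (simp add: const M(2))
qed

text \<open>A function on \<open>H\<close> is spread over \<open>G\<close> along the right cosets of
  \<open>H\<close>: with a representative \<open>c x\<close> in each coset, use
  \<open>u (x \<otimes> inv (c x))\<close>. Left multiplication by elements of \<open>H\<close>
  stays in the coset, so the inequality on \<open>H\<close> is inherited on all of \<open>G\<close>,
  and the mean on \<open>G\<close> itself can be used.\<close>

lemma amenable_no_strict_superharmonic_on_subgroup:
  fixes G :: "('g, 'm) monoid_scheme" (structure) and u :: "'g \<Rightarrow> real"
  assumes am: "amenable_group G"
    and fs: "finitely_supported_distribution_on G \<mu>"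
    and sym: "symmetric_distribution G \<mu>"
    and H: "subgroup H G" "set_pmf \<mu> \<subseteq> H"
    and pos: "\<And>x. x \<in> H \<Longrightarrow> 0 < u x"
    and l: "0 < l"
    and sup: "\<And>x. x \<in> H \<Longrightarrow> l * (\<Sum>s\<in>set_pmf \<mu>. pmf \<mu> s * u (inv\<^bsub>G\<^esub> s \<otimes>\<^bsub>G\<^esub> x)) \<le> u x"
  shows "l \<le> 1"
proof -
  interpret group G using am unfolding amenable_group_def by simp
  \<comment> \<open>The choice depends on the coset as a set, so \<open>c\<close> is constant on
    each coset.\<close>
  define c where "c x = (SOME y. y \<in> H #> x)" for x
  have c: "c x \<in> H #> x" if "x \<in> carrier G" for x
    unfolding c_def using rcos_self[OF that H(1)] by (rule someI)
  have cG: "c x \<in> carrier G" if "x \<in> carrier G" for x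
    using c[OF that] r_coset_subset_G[OF subgroup.subset[OF H(1)] that] by blast
  have cH: "x \<otimes> inv (c x) \<in> H" if x: "x \<in> carrier G" for x
  proof -
    obtain h where h: "h \<in> H" "c x = h \<otimes> x"
      using c[OF x] unfolding r_coset_def by blast
    then have "x \<otimes> inv (c x) = inv h"
      using x subgroup.mem_carrier[OF H(1)] by (simp add: inv_mult_group m_assoc[symmetric])
    then show ?thesis using subgroup.m_inv_closed[OF H(1) h(1)] by simp
  qed
  have cinv: "c (h \<otimes> x) = c x" if "h \<in> H" "x \<in> carrier G" for h x
  proof -
    have "h \<otimes> x \<in> H #> x" using that unfolding r_coset_def by blast
    then have "H #> x = H #> (h \<otimes> x)" using that H(1) by (intro repr_independence) auto
    then show ?thesis unfolding c_def by simp
  qed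
  show ?thesis
  proof (rule amenable_no_strict_superharmonic[OF am fs sym, of "\<lambda>x. u (x \<otimes> inv (c x))" l])
    fix x assume x: "x \<in> carrier G"
    show "0 < u (x \<otimes> inv (c x))" using pos cH x by simp
    have "inv s \<otimes> x \<otimes> inv (c (inv s \<otimes> x)) = inv s \<otimes> (x \<otimes> inv (c x))" if "s \<in> set_pmf \<mu>" for s
    proof -
      have "inv s \<in> H" using that H by (meson subgroup.m_inv_closed subsetD)
      then show ?thesis using cinv[of "inv s" x] x cG subgroup.mem_carrier[OF H(1)]
        by (simp add: m_assoc)
    qed
    then show "l * (\<Sum>s\<in>set_pmf \<mu>. pmf \<mu> s * u (inv s \<otimes> x \<otimes> inv (c (inv s \<otimes> x)))) \<le> u (x \<otimes> inv (c x))"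
      using sup[OF cH[OF x]] by simp
  qed (rule l)
qed

section \<open>Iterated convolution on an order-bounded representation\<close>

locale symmetric_walk_representation =
  fixes G :: "('g, 'm) monoid_scheme" (structure)
    and \<mu> :: "'g pmf"
    and \<phi> :: "'g \<Rightarrow> 'v::ordered_real_vector \<Rightarrow> 'v"
  assumes amenable: "amenable_group G"
    and finsupp: "finitely_supported_distribution_on G \<mu>"
    and symm: "symmetric_distribution G \<mu>"
    and rep: "ordered_representation G \<phi>"
    and obdd: "order_bounded G \<phi>"
begin

sublocale group G
  using amenable unfolding amenable_group_def by simp

abbreviation P :: "'v \<Rightarrow> 'v" where "P \<equiv> convolve \<phi> \<mu>"

lemma fin: "finite (set_pmf \<mu>)" and supp: "s \<in> set_pmf \<mu> \<Longrightarrow> s \<in> carrier G"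
  using finsupp unfolding finitely_supported_distribution_on_def by auto

lemma inv_supp: "s \<in> set_pmf \<mu> \<Longrightarrow> inv s \<in> set_pmf \<mu>"
  using symmetric_inv_mem[OF symm] supp by blast

lemma act_mult:
  assumes "g \<in> carrier G" "h \<in> carrier G" shows "\<phi> g (\<phi> h v) = \<phi> (g \<otimes> h) v"
  using assms rep group_action.composition_rule[of G UNIV \<phi> v g h]
  unfolding ordered_representation_def by simp

lemma act_one: "\<phi> \<one> v = v"
  using rep group_action.id_eq_one[of G UNIV \<phi>] unfolding ordered_representation_def
  by (metis UNIV_I restrict_apply')

lemma act_linear: "g \<in> carrier G \<Longrightarrow> linear (\<phi> g)"
  using rep unfolding ordered_representation_def positive_map_def by blast

lemma act_nonneg: "g \<in> carrier G \<Longrightarrow> 0 \<le> v \<Longrightarrow> 0 \<le> \<phi> g v"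
  using rep unfolding ordered_representation_def positive_map_def by simp

lemma act_convolve:
  assumes g: "g \<in> carrier G"
  shows "\<phi> g (P v) = (\<Sum>s\<in>set_pmf \<mu>. pmf \<mu> s *\<^sub>R \<phi> (g \<otimes> s) v)"
  using g by (simp add: convolve_def linear_sum[OF act_linear] linear_scale[OF act_linear]
      act_mult supp)

lemma convolve_add: "P (u + v) = P u + P v"
  by (simp add: convolve_def linear_add[OF act_linear] supp scaleR_add_right sum.distrib)

lemma convolve_zero: "P 0 = 0"
  by (simp add: convolve_def linear_0[OF act_linear] supp)

lemma convolve_nonneg: "0 \<le> v \<Longrightarrow> 0 \<le> P v"
  unfolding convolve_def by (intro sum_nonneg scaleR_nonneg_nonneg act_nonneg supp) auto

lemma iterate_add: "(P ^^ n) (u + v) = (P ^^ n) u + (P ^^ n) v"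
  by (induction n) (simp_all add: convolve_add)

lemma iterate_nonneg: "0 \<le> v \<Longrightarrow> 0 \<le> (P ^^ n) v"
  by (induction n) (simp_all add: convolve_nonneg)

text \<open>A vanishing sum of positive vectors vanishes termwise, and each \<open>\<phi> s\<close>
  is invertible. This gives stationarity of prices relative to \<open>0\<close>, which only
  distinguish zero from nonzero vectors.\<close>

lemma convolve_eq_zero:
  assumes v: "0 \<le> v" and z: "P v = 0"
  shows "v = 0"
proof -
  obtain s where s: "s \<in> set_pmf \<mu>" using set_pmf_not_empty[of \<mu>] by blast
  have "pmf \<mu> s *\<^sub>R \<phi> s v = 0"
    using z s fin act_nonneg[OF supp v] unfolding convolve_def
    by (subst (asm) sum_nonneg_eq_0_iff) (auto intro!: scaleR_nonneg_nonneg)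
  then have "\<phi> s v = 0" using s by (simp add: set_pmf_iff)
  then have "\<phi> (inv s) (\<phi> s v) = 0" using linear_0[OF act_linear] s supp by simp
  then show ?thesis using s supp by (simp add: act_mult act_one)
qed

text \<open>An orbit bound of \<open>v\<close> persists: translates of the next iterate are convex
  combinations of translates of the previous one. The induction therefore runs over all
  \<open>g\<close> at once.\<close>

lemma iterates_bounded_above:
  obtains w where "\<And>g n. g \<in> carrier G \<Longrightarrow> \<phi> g ((P ^^ n) v) \<le> w"
proof -
  obtain w where w: "\<phi> g v \<le> w" if "g \<in> carrier G" for g
    using obdd unfolding order_bounded_def orbit_def bdd_above_def by blast
  have "\<phi> g ((P ^^ n) v) \<le> w" if "g \<in> carrier G" for g n
    using that
  proof (induction n arbitrary: g)
    case (Suc n)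
    have "\<phi> g ((P ^^ Suc n) v) = (\<Sum>s\<in>set_pmf \<mu>. pmf \<mu> s *\<^sub>R \<phi> (g \<otimes> s) ((P ^^ n) v))"
      using act_convolve[OF Suc.prems] by simp
    also have "\<dots> \<le> (\<Sum>s\<in>set_pmf \<mu>. pmf \<mu> s *\<^sub>R w)"
      using Suc supp by (intro sum_mono scaleR_left_mono) auto
    also have "\<dots> = w" using sum_pmf_support[OF fin] by (simp flip: scaleR_left.sum)
    finally show ?case .
  qed (use w in simp)
  then show thesis using that by blast
qed

text \<open>
  If the series converged, its sums along the orbit of \<open>v\<close> would form a strictly superharmonic
  function on the subgroup generated by the support of \<open>\<mu>\<close>.
\<close>

lemma iterates_not_summable:
  fixes f :: "'v \<Rightarrow> real"
  assumes f: "positive_map f" and v: "0 \<le> v" "0 < f v" and l: "1 < l"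
  shows "\<not> summable (\<lambda>n. l ^ n * f ((P ^^ n) v))"
proof
  assume sm: "summable (\<lambda>n. l ^ n * f ((P ^^ n) v))"
  have flin: "linear f" and fpos: "0 \<le> x \<Longrightarrow> 0 \<le> f x" for x
    using f unfolding positive_map_def by auto
  \<comment> \<open>The inverse turns \<open>inv s \<otimes> x\<close> into
    \<open>inv x \<otimes> s\<close>, the form in which \<open>act_convolve\<close> averages;
    averaging over \<open>s\<close> thus raises \<open>n\<close> by one, as \<open>rec\<close>
    states.\<close>
  define t where "t n x = l ^ n * f (\<phi> (inv x) ((P ^^ n) v))" for n x
  define u where "u x = (\<Sum>n. t n x)" for x
  \<comment> \<open>The value of \<open>u\<close> is meaningful only where the series converges, so
    convergence and positivity are propagated together, starting from \<open>\<one>\<close>.\<close>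
  define ok where "ok x \<longleftrightarrow> summable (\<lambda>n. t n x) \<and> 0 < u x" for x
  have t0: "0 \<le> t n x" if "x \<in> carrier G" for n x
    using that l unfolding t_def by (auto intro!: mult_nonneg_nonneg fpos act_nonneg iterate_nonneg v)
  have rec: "l * (\<Sum>s\<in>set_pmf \<mu>. pmf \<mu> s * t n (inv s \<otimes> x)) = t (Suc n) x"
    if x: "x \<in> carrier G" for n x
  proof -
    have "f (\<phi> (inv x) (P ((P ^^ n) v)))
        = (\<Sum>s\<in>set_pmf \<mu>. pmf \<mu> s * f (\<phi> (inv (inv s \<otimes> x)) ((P ^^ n) v)))"
      using x supp by (simp add: act_convolve linear_sum[OF flin] linear_scale[OF flin] inv_mult_group)
    then show ?thesis unfolding t_def by (simp add: sum_distrib_left mult_ac)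
  qed
  have step: "l * pmf \<mu> s * t n (inv s \<otimes> x) \<le> t (Suc n) x"
    if "x \<in> carrier G" "s \<in> set_pmf \<mu>" for n x s
  proof -
    have "pmf \<mu> s * t n (inv s \<otimes> x) \<le> (\<Sum>s\<in>set_pmf \<mu>. pmf \<mu> s * t n (inv s \<otimes> x))"
      using that fin supp by (intro member_le_sum) (auto intro!: mult_nonneg_nonneg t0)
    then have "l * (pmf \<mu> s * t n (inv s \<otimes> x)) \<le> l * (\<Sum>s\<in>set_pmf \<mu>. pmf \<mu> s * t n (inv s \<otimes> x))"
      using l by (intro mult_left_mono) auto
    then show ?thesis using rec[OF that(1)] by (simp add: mult.assoc)
  qed
  have usuc: "u x = t 0 x + (\<Sum>n. t (Suc n) x)" if "summable (\<lambda>n. t n x)" for x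
    using suminf_split_head[OF that] unfolding u_def by simp
  \<comment> \<open>Convergence at a neighbour of \<open>x\<close> follows by comparison with the
    shifted series at \<open>x\<close>.\<close>
  have sm_step: "summable (\<lambda>n. t n (inv s \<otimes> x)) \<and> l * pmf \<mu> s * u (inv s \<otimes> x) \<le> u x"
    if x: "x \<in> carrier G" and s: "s \<in> set_pmf \<mu>" and sx: "summable (\<lambda>n. t n x)" for x s
  proof -
    have p: "0 < l * pmf \<mu> s" using l s by (simp add: pmf_positive)
    have ss: "summable (\<lambda>n. t (Suc n) x)" using sx by (rule iffD2[OF summable_Suc_iff[of "\<lambda>n. t n x"]])
    have "summable (\<lambda>n. l * pmf \<mu> s * t n (inv s \<otimes> x))"
    proof (rule summable_comparison_test'[OF ss, of 0])
      fix n
      have "0 \<le> l * pmf \<mu> s * t n (inv s \<otimes> x)"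
        using x s supp by (intro mult_nonneg_nonneg[OF less_imp_le[OF p]] t0) auto
      then show "norm (l * pmf \<mu> s * t n (inv s \<otimes> x)) \<le> t (Suc n) x"
        using step[OF x s, of n] by simp
    qed
    then have sy: "summable (\<lambda>n. t n (inv s \<otimes> x))"
      using p by (subst (asm) summable_cmult_iff) auto
    have "l * pmf \<mu> s * u (inv s \<otimes> x) = (\<Sum>n. l * pmf \<mu> s * t n (inv s \<otimes> x))"
      unfolding u_def using sy by (rule suminf_mult[symmetric])
    also have "\<dots> \<le> (\<Sum>n. t (Suc n) x)"
      using step[OF x s] sy ss by (intro suminf_le summable_mult)
    also have "\<dots> \<le> u x" using usuc[OF sx] t0[OF x] by simp
    finally show ?thesis using sy by blast
  qed
  \<comment> \<open>Positivity at the neighbour comes from the step back to \<open>x\<close>, which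
    is possible because the support is closed under inverses.\<close>
  have ok_step: "ok (inv s \<otimes> x)" if x: "x \<in> carrier G" and s: "s \<in> set_pmf \<mu>" and o: "ok x" for x s
  proof -
    let ?y = "inv s \<otimes> x"
    have y: "?y \<in> carrier G" and xy: "inv (inv s) \<otimes> ?y = x"
      using x s supp by (auto simp: m_assoc[symmetric])
    have sy: "summable (\<lambda>n. t n ?y)" using sm_step[OF x s] o unfolding ok_def by blast
    have "l * pmf \<mu> (inv s) * u x \<le> u ?y"
      using sm_step[OF y inv_supp[OF s] sy] xy by simp
    moreover have "0 < l * pmf \<mu> (inv s) * u x"
      using l inv_supp[OF s] o unfolding ok_def by (simp add: pmf_positive)
    ultimately show ?thesis using sy unfolding ok_def by linarith
  qed
  have ok_step': "ok (s \<otimes> x)" if "x \<in> carrier G" "s \<in> set_pmf \<mu>" "ok x" for x s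
    using ok_step[OF that(1) inv_supp[OF that(2)] that(3)] that supp by simp
  \<comment> \<open>The support may fail to generate \<open>G\<close>, and \<open>ok\<close> spreads
    only along products of its elements and their inverses.\<close>
  let ?H = "generate G (set_pmf \<mu>)"
  have sub: "set_pmf \<mu> \<subseteq> carrier G" using supp by blast
  have H: "subgroup ?H G" by (rule generate_is_subgroup[OF sub])
  have gen: "\<forall>x\<in>carrier G. ok x \<longrightarrow> ok (h \<otimes> x)" if "h \<in> ?H" for h
    using that
  proof (induction h rule: generate.induct)
    case (eng h1 h2)
    then show ?case using generate_in_carrier[OF sub] by (auto simp: m_assoc)
  qed (auto intro: ok_step ok_step')
  have "u \<one> \<ge> t 0 \<one>"
  proof -
    have "summable (\<lambda>n. t n \<one>)" using sm by (simp add: t_def act_one)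
    from sum_le_suminf[OF this, of "{0}"] show ?thesis unfolding u_def using t0 by simp
  qed
  then have "ok \<one>" using sm v unfolding ok_def by (simp add: t_def act_one)
  then have okH: "ok h" if "h \<in> ?H" for h
    using gen[OF that] generate_in_carrier[OF sub that] by (metis one_closed r_one)
  have "l \<le> 1"
  proof (rule amenable_no_strict_superharmonic_on_subgroup[OF amenable finsupp symm H, of u])
    show "set_pmf \<mu> \<subseteq> ?H" by (auto intro: generate.incl)
    show "0 < u x" if "x \<in> ?H" for x using okH[OF that] unfolding ok_def by simp
    \<comment> \<open>After exchanging the sums, \<open>rec\<close> turns the left side into the
      series for \<open>u x\<close> without its nonnegative term at \<open>n = 0\<close>.\<close>
    show "l * (\<Sum>s\<in>set_pmf \<mu>. pmf \<mu> s * u (inv s \<otimes> x)) \<le> u x" if xH: "x \<in> ?H" for x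
    proof -
      have x: "x \<in> carrier G" using generate_in_carrier[OF sub xH] .
      have sx: "summable (\<lambda>n. t n x)" using okH[OF xH] unfolding ok_def by simp
      have sy: "summable (\<lambda>n. pmf \<mu> s * t n (inv s \<otimes> x))" if "s \<in> set_pmf \<mu>" for s
        using sm_step[OF x that sx] by (intro summable_mult) simp
      have "l * (\<Sum>s\<in>set_pmf \<mu>. pmf \<mu> s * u (inv s \<otimes> x))
          = l * (\<Sum>s\<in>set_pmf \<mu>. \<Sum>n. pmf \<mu> s * t n (inv s \<otimes> x))"
        unfolding u_def using sm_step[OF x _ sx] by (simp add: suminf_mult)
      also have "\<dots> = l * (\<Sum>n. \<Sum>s\<in>set_pmf \<mu>. pmf \<mu> s * t n (inv s \<otimes> x))"
        using sy by (subst suminf_sum) auto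
      also have "\<dots> = (\<Sum>n. t (Suc n) x)"
        using sy rec[OF x] by (subst suminf_mult[symmetric]) (auto intro: summable_sum)
      also have "\<dots> \<le> u x" using usuc[OF sx] t0[OF x] by simp
      finally show ?thesis .
    qed
  qed (use l in auto)
  then show False using l by simp
qed

section \<open>Almost stationary functionals\<close>

definition almost_stationary :: "'v set \<Rightarrow> real \<Rightarrow> ('v \<Rightarrow> real) \<Rightarrow> bool" where
  "almost_stationary F l f \<longleftrightarrow>
     (\<forall>u\<ge>0. 0 \<le> f u) \<and> (\<forall>u\<ge>0. \<forall>v\<ge>0. f (u + v) = f u + f v) \<and>
     (\<forall>v\<in>F. 0 < f v \<and> f (P v) \<le> l * f v \<and> f v \<le> l * f (P v))"

lemma almost_stationaryI:
  assumes "\<And>u. 0 \<le> u \<Longrightarrow> 0 \<le> f u"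
    and "\<And>u v. 0 \<le> u \<Longrightarrow> 0 \<le> v \<Longrightarrow> f (u + v) = f u + f v"
    and "\<And>v. v \<in> F \<Longrightarrow> 0 < f v" "\<And>v. v \<in> F \<Longrightarrow> f (P v) \<le> l * f v"
      "\<And>v. v \<in> F \<Longrightarrow> f v \<le> l * f (P v)"
  shows "almost_stationary F l f"
  using assms unfolding almost_stationary_def by simp

lemma almost_stationaryD:
  assumes "almost_stationary F l f"
  shows "0 \<le> u \<Longrightarrow> 0 \<le> f u"
    and "0 \<le> u \<Longrightarrow> 0 \<le> v \<Longrightarrow> f (u + v) = f u + f v"
    and "v \<in> F \<Longrightarrow> 0 < f v" "v \<in> F \<Longrightarrow> f (P v) \<le> l * f v" "v \<in> F \<Longrightarrow> f v \<le> l * f (P v)"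
  using assms unfolding almost_stationary_def by simp_all

lemma almost_stationary_mono:
  assumes f: "almost_stationary F l f" and "F' \<subseteq> F" "l \<le> l'" and F: "F \<subseteq> {0<..}"
  shows "almost_stationary F' l' f"
proof (rule almost_stationaryI)
  fix v assume "v \<in> F'"
  then have v: "v \<in> F" "0 \<le> v" using assms(2) F by (auto simp: subset_iff less_imp_le)
  have "l * f v \<le> l' * f v" "l * f (P v) \<le> l' * f (P v)"
    using assms(3) almost_stationaryD(1)[OF f] v(2) convolve_nonneg
    by (simp_all add: mult_right_mono)
  then show "0 < f v" "f (P v) \<le> l' * f v" "f v \<le> l' * f (P v)"
    using almost_stationaryD(3-5)[OF f v(1)] by linarith+
qed (use almost_stationaryD[OF f] in blast)+

text \<open>
  The weights grow like \<open>k ^ n\<close> long enough for the divergence to make the boundary term at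
  \<open>n = 0\<close> negligible, and then decay geometrically to ensure convergence.
\<close>

lemma almost_stationary_functional:
  fixes f0 :: "'v \<Rightarrow> real"
  assumes f0: "positive_map f0" and F: "finite F" "\<And>v. v \<in> F \<Longrightarrow> 0 \<le> v" "\<And>v. v \<in> F \<Longrightarrow> 0 < f0 v"
    and l: "1 < l"
  shows "\<exists>f. almost_stationary F l f"
proof -
  have flin: "linear f0" and fpos: "0 \<le> x \<Longrightarrow> 0 \<le> f0 x" for x
    using f0 unfolding positive_map_def by auto
  \<comment> \<open>One factor \<open>k\<close> pays for the variation of the weights between
    neighbouring indices, the other for the boundary term in the lower estimate.\<close>
  define k where "k = sqrt l"
  have k: "1 < k" "k * k = l" using l unfolding k_def by auto
  define b where "b n v = f0 ((P ^^ n) v)" for n v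
  have b0: "0 \<le> b n v" if "0 \<le> v" for n v
    unfolding b_def by (intro fpos iterate_nonneg that)
  \<comment> \<open>Order-boundedness enters here: all iterates lie below one vector
    \<open>w\<close>, so \<open>f0 w\<close> bounds their values.\<close>
  have bbound: "\<exists>C. \<forall>n. b n v \<le> C" for v
  proof -
    obtain w where "\<And>g n. g \<in> carrier G \<Longrightarrow> \<phi> g ((P ^^ n) v) \<le> w"
      using iterates_bounded_above[of v] by blast
    from this[OF one_closed] have "(P ^^ n) v \<le> w" for n by (simp add: act_one)
    then have "0 \<le> f0 (w - (P ^^ n) v)" for n by (intro fpos) simp
    then show ?thesis unfolding b_def by (auto simp: linear_diff[OF flin])
  qed
  \<comment> \<open>The partial sums are unbounded by \<open>iterates_not_summable\<close>. The
    constant \<open>1 - 1/k\<close> is chosen so that moving the boundary term to the other side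
    leaves \<open>f v / k\<close>.\<close>
  have "\<forall>\<^sub>F N in sequentially. b 0 v \<le> (1 - 1/k) * (\<Sum>n<N. k ^ n * b n v)" if v: "v \<in> F" for v
  proof -
    have d: "0 < 1 - 1/k" using k by simp
    have pos: "0 \<le> k ^ n * b n v" for n using k b0[OF F(2)[OF v]] by simp
    obtain N0 where N0: "b 0 v / (1 - 1/k) < (\<Sum>n<N0. k ^ n * b n v)"
      using iterates_not_summable[OF f0 F(2)[OF v] F(3)[OF v] k(1)] pos
        summableI_nonneg_bounded[of "\<lambda>n. k ^ n * b n v" "b 0 v / (1 - 1/k)"]
      unfolding b_def by (meson not_less)
    have "b 0 v \<le> (1 - 1/k) * (\<Sum>n<N. k ^ n * b n v)" if "N0 \<le> N" for N
    proof -
      have "(\<Sum>n<N0. k ^ n * b n v) \<le> (\<Sum>n<N. k ^ n * b n v)"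
        using that pos by (intro sum_mono2) auto
      with N0 have "b 0 v / (1 - 1/k) \<le> (\<Sum>n<N. k ^ n * b n v)" by linarith
      then show ?thesis by (subst (asm) pos_divide_le_eq[OF d]) (simp add: mult.commute)
    qed
    then show ?thesis unfolding eventually_sequentially by blast
  qed
  then have "\<forall>\<^sub>F N in sequentially. \<forall>v\<in>F. b 0 v \<le> (1 - 1/k) * (\<Sum>n<N. k ^ n * b n v)"
    using F(1) by (simp add: eventually_ball_finite)
  then obtain N where N: "\<And>v. v \<in> F \<Longrightarrow> b 0 v \<le> (1 - 1/k) * (\<Sum>n<N. k ^ n * b n v)"
    unfolding eventually_sequentially by blast
  \<comment> \<open>With this \<open>K\<close> the two branches of the minimum in \<open>a\<close>
    meet at \<open>n = N\<close>: the weight is \<open>k ^ n\<close> up to \<open>N\<close> and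
    \<open>k ^ (2 * N) / k ^ n\<close> afterwards.\<close>
  define K where "K = k ^ (2 * N)"
  define a where "a n = min (k ^ n) (K / k ^ n)" for n
  have K: "0 < K" using k unfolding K_def by simp
  have apos: "0 < a n" for n using k K unfolding a_def by simp
  have ka: "k * a n = min (k * k ^ n) (k * (K / k ^ n))" for n
    using k unfolding a_def by (simp add: min_mult_distrib_left)
  have aup: "a (Suc n) \<le> k * a n" for n
  proof -
    have "K / k ^ Suc n \<le> K / k ^ n" using k K by (intro divide_left_mono) auto
    also have "\<dots> \<le> k * (K / k ^ n)" using k K mult_right_mono[of 1 k "K / k ^ n"] by simp
    finally show ?thesis unfolding ka unfolding a_def by (intro min.mono) auto
  qed
  have adown: "a n \<le> k * a (Suc n)" for n
  proof -
    have "k ^ n \<le> k ^ Suc n" using k by (intro power_increasing) auto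
    also have "\<dots> \<le> k * k ^ Suc n" using k by simp
    finally have "k ^ n \<le> k * k ^ Suc n" .
    moreover have "k * (K / k ^ Suc n) = K / k ^ n" using k by simp
    ultimately show ?thesis unfolding ka unfolding a_def by (intro min.mono) auto
  qed
  have aeq: "a n = k ^ n" if "n \<le> N" for n
  proof -
    have "k ^ n * k ^ n \<le> K"
      unfolding K_def using k that by (simp flip: power_add)
    then show ?thesis unfolding a_def using k by (simp add: min_def pos_le_divide_eq)
  qed
  \<comment> \<open>Bounded values against geometric decay. The index map \<open>g\<close> covers
    both the series for \<open>f v\<close> and the shifted one for \<open>f (P v)\<close>.
    Convergence is shown on the cone, which is where \<open>almost_stationary\<close> asks for
    additivity.\<close>
  have smb: "summable (\<lambda>n. a n * b (g n) v)" if v: "0 \<le> v" for v g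
  proof -
    obtain C where C: "\<And>n. b n v \<le> C" using bbound by blast
    have "summable (\<lambda>n. K * (1 / k) ^ n * C)"
      using k by (intro summable_mult2 summable_mult summable_geometric) auto
    then show ?thesis
    proof (rule summable_comparison_test'[of _ 0])
      fix n
      have "a n \<le> K * (1 / k) ^ n" unfolding a_def by (simp add: power_divide)
      then have "a n * b (g n) v \<le> K * (1 / k) ^ n * C"
        using C[of "g n"] b0[OF v, of "g n"] K k by (intro mult_mono) auto
      then show "norm (a n * b (g n) v) \<le> K * (1 / k) ^ n * C"
        using apos[of n] b0[OF v, of "g n"] by simp
    qed
  qed
  have ab0: "0 \<le> a n * b m v" if "0 \<le> v" for n m v
    using apos[of n] b0[OF that] by simp
  define f where "f v = (\<Sum>n. a n * b n v)" for v
  have sn: "summable (\<lambda>n. a n * b n v)" and sS: "summable (\<lambda>n. a n * b (Suc n) v)"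
    and sSS: "summable (\<lambda>n. a (Suc n) * b (Suc n) v)" if "0 \<le> v" for v
    using smb[OF that, of "\<lambda>n. n"] smb[OF that, of Suc]
      iffD2[OF summable_Suc_iff smb[OF that, of "\<lambda>n. n"]] by simp_all
  have fP: "f (P v) = (\<Sum>n. a n * b (Suc n) v)" for v
    unfolding f_def b_def by (simp add: funpow_swap1)
  have split: "f v = a 0 * b 0 v + (\<Sum>n. a (Suc n) * b (Suc n) v)" if "0 \<le> v" for v
    using suminf_split_head[OF sn[OF that]] unfolding f_def by simp
  have "almost_stationary F l f"
  proof (rule almost_stationaryI)
    show "0 \<le> f u" if "0 \<le> u" for u
      unfolding f_def by (intro suminf_nonneg sn ab0 that)
    show "f (u + v) = f u + f v" if "0 \<le> u" "0 \<le> v" for u v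
      unfolding f_def using suminf_add[OF sn[OF that(1)] sn[OF that(2)]]
      by (simp add: b_def iterate_add linear_add[OF flin] distrib_left)
    fix v assume vF: "v \<in> F"
    have "0 < f v \<and> f (P v) \<le> l * f v \<and> f v \<le> l * f (P v)"
    proof -
      have v: "0 \<le> v" using F(2)[OF vF] .
      have d: "0 < 1 - 1/k" using k by simp
      have bpos: "0 < b 0 v" using F(3)[OF vF] by (simp add: b_def)
      have "(\<Sum>n<N. k ^ n * b n v) = (\<Sum>n<N. a n * b n v)" by (simp add: aeq)
      also have "\<dots> \<le> f v" unfolding f_def
        by (intro sum_le_suminf sn ab0 v) auto
      finally have "(1 - 1/k) * (\<Sum>n<N. k ^ n * b n v) \<le> (1 - 1/k) * f v"
        using d by (intro mult_left_mono) auto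
      with N[OF vF] have small: "b 0 v \<le> (1 - 1/k) * f v" by linarith
      with bpos have "0 < (1 - 1/k) * f v" by linarith
      then have fv: "0 < f v" using d by (simp add: zero_less_mult_iff)
      have "f (P v) \<le> (\<Sum>n. k * (a (Suc n) * b (Suc n) v))"
        unfolding fP using adown b0[OF v]
        by (intro suminf_le sS v summable_mult sSS) (simp add: mult_right_mono flip: mult.assoc)
      also have "\<dots> = k * (\<Sum>n. a (Suc n) * b (Suc n) v)" by (rule suminf_mult[OF sSS[OF v]])
      also have "\<dots> \<le> k * f v"
        using split[OF v] bpos apos[of 0] k by (intro mult_left_mono) auto
      also have "\<dots> \<le> k * (k * f v)" using k fv by simp
      finally have upper: "f (P v) \<le> l * f v" using k by (simp flip: mult.assoc)
      \<comment> \<open>For the lower estimate the series for \<open>f v\<close> is split at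
        \<open>n = 0\<close>; \<open>aup\<close> compares its tail with \<open>f (P v)\<close>, and
        \<open>small\<close> absorbs the head.\<close>
      have "(\<Sum>n. a (Suc n) * b (Suc n) v) \<le> (\<Sum>n. k * (a n * b (Suc n) v))"
        using aup b0[OF v]
        by (intro suminf_le sSS v summable_mult sS) (simp add: mult_right_mono flip: mult.assoc)
      also have "\<dots> = k * f (P v)" unfolding fP by (rule suminf_mult[OF sS[OF v]])
      finally have "f v \<le> b 0 v + k * f (P v)"
        using split[OF v] aeq[of 0] by simp
      with small have "f v \<le> f v - f v / k + k * f (P v)" by (simp add: left_diff_distrib)
      then have "f v / k \<le> k * f (P v)" by simp
      then have "f v \<le> k * f (P v) * k" using k by (simp add: pos_divide_le_eq)
      then have "f v \<le> l * f (P v)" using k(2) by (simp add: mult_ac flip: mult.assoc)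
      with fv upper show ?thesis by blast
    qed
    then show "0 < f v" "f (P v) \<le> l * f v" "f v \<le> l * f (P v)" by blast+
  qed
  then show ?thesis by blast
qed

end

text \<open>Non-singularity handles one vector at a time; in a sum of positive functionals, a
  summand that is nonzero on a positive vector keeps the sum positive there.\<close>

lemma finite_strictly_positive_functional:
  assumes ns: "non_singular TYPE('v::ordered_real_vector)" and "finite F" "F \<subseteq> {0::'v<..}"
  shows "\<exists>f::'v \<Rightarrow> real. positive_map f \<and> (\<forall>v\<in>F. 0 < f v)"
  using assms(2,3)
proof (induction F rule: finite_induct)
  case empty
  have "linear (\<lambda>x::'v. 0::real)" by (simp add: linear_iff)
  then show ?case unfolding positive_map_def by auto
next
  case (insert v F)
  then obtain f :: "'v \<Rightarrow> real" where f: "positive_map f" "\<And>v. v \<in> F \<Longrightarrow> 0 < f v" by auto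
  have v: "0 \<le> v" "v \<noteq> 0" using insert.prems by auto
  then obtain h :: "'v \<Rightarrow> real" where h: "positive_map h" "h v \<noteq> 0"
    using ns unfolding non_singular_def by auto
  have nn: "0 \<le> f x" "0 \<le> h x" if "0 \<le> x" for x
    using that f h unfolding positive_map_def by auto
  have "linear (\<lambda>x. f x + h x)"
    using f h unfolding positive_map_def by (intro linear_compose_add) auto
  then have "positive_map (\<lambda>x. f x + h x)"
    unfolding positive_map_def using nn by auto
  moreover have "0 < f x + h x" if "x \<in> insert v F" for x
  proof (cases "x = v")
    case True
    then show ?thesis using nn[OF v(1)] h(2) by simp
  next
    case False
    then have "x \<in> F" "0 \<le> x" using that insert.prems by (auto simp: subset_iff less_imp_le)
    then show ?thesis using f(2) nn by (simp add: add_pos_nonneg)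
  qed
  ultimately show ?case by blast
qed

section \<open>Limits of pricings by Tychonoff compactness\<close>

lemma compact_UNIV_fun:
  assumes "compact (UNIV :: 'b::topological_space set)"
  shows "compact (UNIV :: ('a \<Rightarrow> 'b) set)"
  using compactin_PiE[of "\<lambda>_. euclidean :: 'b topology" UNIV "\<lambda>_::'a. UNIV"] assms
  by (simp add: euclidean_product_topology PiE_UNIV_domain)

text \<open>Lets \<open>l\<close> tend to \<open>1\<close>. For finite \<open>y\<close> the case
  \<open>l = 2\<close> already makes \<open>x\<close> finite, and the rest is an argument about
  reals.\<close>

lemma ennreal_le_of_le_mult:
  fixes x y :: ennreal
  assumes le: "\<And>l::real. 1 < l \<Longrightarrow> x \<le> ennreal l * y"
  shows "x \<le> y"
proof (cases y)
  case (real y')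
  have "x \<le> ennreal (2 * y')" using le[of 2] real by (simp add: ennreal_mult)
  then obtain x' where x: "x = ennreal x'" "0 \<le> x'"
    by (metis ennreal_cases ennreal_neq_top neq_top_trans)
  have "x' \<le> y'"
  proof (rule field_le_mult_one_interval)
    fix z :: real assume z: "0 < z" "z < 1"
    then have "ennreal x' \<le> ennreal (1 / z * y')"
      using le[of "1 / z"] real x by (simp only: ennreal_mult'') simp
    then have "x' \<le> 1 / z * y'"
      by (rule iffD1[OF ennreal_le_iff, rotated]) (use real z in auto)
    then show "z * x' \<le> y'" using z by (simp add: field_simps)
  qed
  then show ?thesis using x real by (simp add: ennreal_leI)
qed simp

context symmetric_walk_representation begin

text \<open>Ratios are taken in \<open>ennreal\<close> for the sake of compactness. Since division
  by zero yields \<open>0\<close>, they are trusted only for denominators in \<open>F\<close>, where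
  \<open>f\<close> is positive.\<close>

definition almost_stationary_pricings :: "'v set \<Rightarrow> real \<Rightarrow> ('v \<Rightarrow> 'v \<Rightarrow> ennreal) set" where
  "almost_stationary_pricings F l =
     (\<lambda>f u v. ennreal (f u / f v)) ` {f. almost_stationary F l f}"

lemma almost_stationary_pricings_mono:
  assumes "F' \<subseteq> F" "l \<le> l'" "F \<subseteq> {0<..}"
  shows "almost_stationary_pricings F l \<subseteq> almost_stationary_pricings F' l'"
  unfolding almost_stationary_pricings_def
  by (rule image_mono) (use almost_stationary_mono[OF _ assms] in blast)

lemma almost_stationary_pricings_nonempty:
  assumes ns: "non_singular TYPE('v)" and F: "finite F" "F \<subseteq> {0<..}" and l: "1 < l"
  shows "almost_stationary_pricings F l \<noteq> {}"
proof -
  obtain f0 :: "'v \<Rightarrow> real" where f0: "positive_map f0" "\<And>v. v \<in> F \<Longrightarrow> 0 < f0 v"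
    using finite_strictly_positive_functional[OF ns F] by blast
  have "0 \<le> v" if "v \<in> F" for v using that F(2) by (auto simp: less_imp_le)
  then obtain f where "almost_stationary F l f"
    using almost_stationary_functional[OF f0(1) F(1) _ f0(2) l] by blast
  then show ?thesis unfolding almost_stationary_pricings_def by blast
qed

text \<open>Enlarging \<open>F\<close> and shrinking \<open>l\<close> shrinks these nonempty sets,
  so they generate a proper filter. Compactness gives it a cluster point \<open>x\<close>, and
  adding the neighbourhoods of \<open>x\<close> makes the filter converge to
  \<open>x\<close>.\<close>

lemma pricing_limit:
  assumes ns: "non_singular TYPE('v)"
  obtains \<F> :: "('v \<Rightarrow> 'v \<Rightarrow> ennreal) filter" and x :: "'v \<Rightarrow> 'v \<Rightarrow> ennreal" where
    "\<F> \<noteq> bot"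
    "\<And>u v. ((\<lambda>r. r u v) \<longlongrightarrow> x u v) \<F>"
    "\<And>F l. finite F \<Longrightarrow> F \<subseteq> {0<..} \<Longrightarrow> 1 < l \<Longrightarrow> \<forall>\<^sub>F r in \<F>. r \<in> almost_stationary_pricings F l"
proof -
  define I where "I = {(F::'v set, l::real). finite F \<and> F \<subseteq> {0<..} \<and> 1 < l}"
  define A where "A = (\<lambda>(F, l). principal (almost_stationary_pricings F l))"
  have ne: "({}, 2) \<in> I" unfolding I_def by simp
  have dir: "\<exists>k\<in>I. A k \<le> inf (A i) (A j)" if "i \<in> I" "j \<in> I" for i j
  proof (rule bexI)
    let ?k = "(fst i \<union> fst j, min (snd i) (snd j))"
    show "?k \<in> I" using that unfolding I_def by auto
    have f: "fst i \<union> fst j \<subseteq> {0<..}" using that unfolding I_def by auto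
    have "almost_stationary_pricings (fst i \<union> fst j) (min (snd i) (snd j))
        \<subseteq> almost_stationary_pricings (fst i) (snd i) \<inter> almost_stationary_pricings (fst j) (snd j)"
      by (intro Int_greatest almost_stationary_pricings_mono f) simp_all
    then show "A ?k \<le> inf (A i) (A j)"
      unfolding A_def by (simp add: case_prod_beta inf_principal)
  qed
  have nbi: "A i \<noteq> bot" if "i \<in> I" for i
    using that almost_stationary_pricings_nonempty[OF ns]
    unfolding I_def A_def by (auto simp: principal_eq_bot_iff)
  have "I \<noteq> {}" using ne by blast
  \<comment> \<open>By directedness the infimum is improper only if one of its members is.\<close>
  then have "eventually (\<lambda>_. False) (INF i\<in>I. A i) \<longleftrightarrow> (\<exists>i\<in>I. eventually (\<lambda>_. False) (A i))"
    by (rule eventually_INF_base) (rule dir)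
  then have nb: "(INF i\<in>I. A i) \<noteq> bot"
    using nbi unfolding trivial_limit_def by blast
  have "compact (UNIV :: ('v \<Rightarrow> 'v \<Rightarrow> ennreal) set)"
    by (intro compact_UNIV_fun compact_UNIV)
  then obtain x where x: "inf (nhds x) (INF i\<in>I. A i) \<noteq> bot"
    unfolding compact_filter using nb by auto
  let ?F = "inf (nhds x) (INF i\<in>I. A i)"
  show thesis
  proof
    show "?F \<noteq> bot" by (rule x)
    have t: "((\<lambda>r. r) \<longlongrightarrow> x) ?F" by (simp add: filterlim_def)
    have t1: "((\<lambda>r. r u) \<longlongrightarrow> x u) ?F" for u
      by (rule continuous_on_tendsto_compose[OF continuous_on_product_coordinates[of u] t]) auto
    show "((\<lambda>r. r u v) \<longlongrightarrow> x u v) ?F" for u v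
      by (rule continuous_on_tendsto_compose[OF continuous_on_product_coordinates[of v] t1[of u]]) auto
    show "\<forall>\<^sub>F r in ?F. r \<in> almost_stationary_pricings F l"
      if "finite F" "F \<subseteq> {0<..}" "1 < l" for F l
    proof (rule filter_leD[OF inf.cobounded2])
      show "\<forall>\<^sub>F r in INF i\<in>I. A i. r \<in> almost_stationary_pricings F l"
        by (rule eventually_INF1[of "(F, l)"])
          (use that in \<open>auto simp: I_def A_def eventually_principal\<close>)
    qed
  qed
qed

lemma stationary_pricing_exists:
  assumes ns: "non_singular TYPE('v)"
  shows "\<exists>r. vector_pricing r \<and> stationary_pricing \<phi> \<mu> r"
proof -
  obtain \<F> :: "('v \<Rightarrow> 'v \<Rightarrow> ennreal) filter" and x :: "'v \<Rightarrow> 'v \<Rightarrow> ennreal" where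
    nt: "\<F> \<noteq> bot" and lim: "\<And>u v. ((\<lambda>r. r u v) \<longlongrightarrow> x u v) \<F>" and
    ev: "\<And>F l. finite F \<Longrightarrow> F \<subseteq> {0<..} \<Longrightarrow> 1 < l \<Longrightarrow> \<forall>\<^sub>F r in \<F>. r \<in> almost_stationary_pricings F l"
    using pricing_limit[OF ns] by blast
  \<comment> \<open>The pricing axioms hold exactly for the ratios once the denominators lie in
    \<open>F\<close>, so any admissible \<open>l\<close>, here \<open>2\<close>, serves.\<close>
  have add: "x (u + v) w = x u w + x v w" if "0 \<le> u" "0 \<le> v" "0 < w" for u v w
  proof (rule tendsto_unique[OF nt lim])
    have "\<forall>\<^sub>F r in \<F>. r u w + r v w = r (u + v) w"
    proof (rule eventually_mono[OF ev[of "{w}" 2]])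
      fix r assume "r \<in> almost_stationary_pricings {w} 2"
      then obtain f where f: "almost_stationary {w} 2 f" and r: "r = (\<lambda>u v. ennreal (f u / f v))"
        unfolding almost_stationary_pricings_def by blast
      have "f (u + v) / f w = f u / f w + f v / f w" "0 \<le> f u / f w" "0 \<le> f v / f w"
        using almost_stationaryD(1,2,3)[OF f] that by (simp_all add: add_divide_distrib less_imp_le)
      then show "r u w + r v w = r (u + v) w" unfolding r by (simp only: ennreal_plus)
    qed (use that in auto)
    moreover have "((\<lambda>r. r u w + r v w) \<longlongrightarrow> x u w + x v w) \<F>"
      by (intro tendsto_add lim)
    ultimately show "((\<lambda>r. r (u + v) w) \<longlongrightarrow> x u w + x v w) \<F>"
      by (rule Lim_transform_eventually[rotated])
  qed
  have refl: "x u u = 1" if "0 < u" for u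
  proof (rule tendsto_unique[OF nt lim])
    have "\<forall>\<^sub>F r in \<F>. 1 = r u u"
    proof (rule eventually_mono[OF ev[of "{u}" 2]])
      fix r assume "r \<in> almost_stationary_pricings {u} 2"
      then obtain f where f: "almost_stationary {u} 2 f" and r: "r = (\<lambda>u v. ennreal (f u / f v))"
        unfolding almost_stationary_pricings_def by blast
      then show "1 = r u u" using almost_stationaryD(3)[OF f, of u] by simp
    qed (use that in auto)
    then show "((\<lambda>r. r u u) \<longlongrightarrow> 1) \<F>"
      by (rule Lim_transform_eventually[OF tendsto_const])
  qed
  have mult: "x u w = x u v * x v w"
    if "0 \<le> u" "0 < v" "0 < w" "product_defined (x u v) (x v w)" for u v w
  proof (rule tendsto_unique[OF nt lim])
    have "\<forall>\<^sub>F r in \<F>. r u v * r v w = r u w"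
    proof (rule eventually_mono[OF ev[of "{v, w}" 2]])
      fix r assume "r \<in> almost_stationary_pricings {v, w} 2"
      then obtain f where f: "almost_stationary {v, w} 2 f" and r: "r = (\<lambda>u v. ennreal (f u / f v))"
        unfolding almost_stationary_pricings_def by blast
      have "0 \<le> f u" "0 < f v" "0 < f w"
        using almost_stationaryD(1,3)[OF f] that by simp_all
      then have "f u / f w = f u / f v * (f v / f w)" "0 \<le> f u / f v" "0 \<le> f v / f w"
        by simp_all
      then show "r u v * r v w = r u w" unfolding r by (simp only: ennreal_mult)
    qed (use that in auto)
    \<comment> \<open>Multiplication on \<open>ennreal\<close> is continuous away from the pairs of
      \<open>0\<close> and \<open>\<infinity>\<close>, which \<open>product_defined\<close>
      excludes.\<close>
    moreover have "((\<lambda>r. r u v * r v w) \<longlongrightarrow> x u v * x v w) \<F>"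
      using that(4) unfolding product_defined_def by (intro tendsto_mult_ennreal lim) auto
    ultimately show "((\<lambda>r. r u w) \<longlongrightarrow> x u v * x v w) \<F>"
      by (rule Lim_transform_eventually[rotated])
  qed
  \<comment> \<open>For fixed \<open>l\<close> both inequalities survive the limit with the factor
    \<open>l\<close>; only then does \<open>l\<close> tend to \<open>1\<close>.\<close>
  have stat: "x (P u) v \<le> x u v" "x u v \<le> x (P u) v" if uv: "0 < u" "0 < v" for u v
  proof -
    have *: "\<forall>\<^sub>F r in \<F>. r (P u) v \<le> ennreal l * r u v \<and> r u v \<le> ennreal l * r (P u) v"
      if l: "1 < l" for l
    proof (rule eventually_mono[OF ev[of "{u, v}" l]])
      fix r assume "r \<in> almost_stationary_pricings {u, v} l"
      then obtain f where f: "almost_stationary {u, v} l f" and r: "r = (\<lambda>u v. ennreal (f u / f v))"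
        unfolding almost_stationary_pricings_def by blast
      have pos: "0 < f v" "0 \<le> f u" "0 \<le> f (P u)"
        using almost_stationaryD(1,3)[OF f] uv convolve_nonneg[of u] by (simp_all add: less_imp_le)
      have "f (P u) / f v \<le> l * (f u / f v)" "f u / f v \<le> l * (f (P u) / f v)"
        using pos almost_stationaryD(4,5)[OF f, of u] by (simp_all add: divide_right_mono)
      then have "ennreal (f (P u) / f v) \<le> ennreal (l * (f u / f v))"
        "ennreal (f u / f v) \<le> ennreal (l * (f (P u) / f v))" by (simp_all only: ennreal_leI)
      moreover have "ennreal (l * (f u / f v)) = ennreal l * ennreal (f u / f v)"
        "ennreal (l * (f (P u) / f v)) = ennreal l * ennreal (f (P u) / f v)"
        using l pos by (intro ennreal_mult; simp)+
      ultimately show "r (P u) v \<le> ennreal l * r u v \<and> r u v \<le> ennreal l * r (P u) v"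
        unfolding r by (simp only:)
    qed (use uv l in auto)
    have lm: "((\<lambda>r. ennreal l * r u v) \<longlongrightarrow> ennreal l * x u v) \<F>" for l u v
      by (intro ennreal_tendsto_cmult lim) simp
    show "x (P u) v \<le> x u v"
    proof (rule ennreal_le_of_le_mult)
      fix l :: real assume "1 < l"
      then show "x (P u) v \<le> ennreal l * x u v"
        by (intro tendsto_le[OF nt lm lim] eventually_mono[OF *]) blast+
    qed
    show "x u v \<le> x (P u) v"
    proof (rule ennreal_le_of_le_mult)
      fix l :: real assume "1 < l"
      then show "x u v \<le> ennreal l * x (P u) v"
        by (intro tendsto_le[OF nt lm lim] eventually_mono[OF *]) blast+
    qed
  qed
  have zero: "x 0 w = 0" if w: "0 < w" for w
  proof -
    have "x w w = x 0 w + x w w" using add[of 0 w w] w by (simp add: less_imp_le)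
    then show ?thesis using refl[OF w] by simp
  qed
  \<comment> \<open>The limit is controlled only for positive denominators. At denominator
    \<open>0\<close> the values are forced: \<open>r 0 u = 0\<close> and \<open>r u u = 1\<close>
    make a finite \<open>r u 0\<close> contradict multiplicativity for
    \<open>u \<noteq> 0\<close>.\<close>
  define r where "r u w = (if w = 0 then if u = 0 then 1 else \<infinity> else x u w)" for u w
  have lt: "0 < w" if "0 \<le> w" "w \<noteq> 0" for w :: 'v using that by simp
  have "r (u + v) w = r u w + r v w" if "0 \<le> u" "0 \<le> v" "0 \<le> w" "w \<noteq> 0" for u v w
    using add[OF that(1,2) lt[OF that(3,4)]] that(4) unfolding r_def by simp
  moreover have "r u w = r u v * r v w"
    if "0 \<le> u" "0 \<le> v" "0 \<le> w" "product_defined (r u v) (r v w)" for u v w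
  proof (cases "v = 0 \<or> w = 0")
    case True
    have "x 0 w = 0" if "w \<noteq> 0" using zero lt that \<open>0 \<le> w\<close> by blast
    moreover have "x 0 v = 0" if "v \<noteq> 0" using zero lt that \<open>0 \<le> v\<close> by blast
    \<comment> \<open>With a zero denominator, either the product is one of the excluded ones or
      both sides agree, because \<open>0\<close> has price \<open>0\<close> relative to nonzero
      vectors.\<close>
    ultimately show ?thesis using True that(4) unfolding r_def product_defined_def
      by (auto split: if_splits simp: ennreal_mult_top ennreal_top_mult)
  next
    case False
    then show ?thesis
      using that mult[OF that(1) lt[OF that(2)] lt[OF that(3)]] unfolding r_def by simp
  qed
  moreover have "r u u = 1" if "0 \<le> u" for u
    using refl[OF lt[OF that]] unfolding r_def by simp
  ultimately have "vector_pricing r"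
    unfolding vector_pricing_def atLeast_iff by blast
  moreover have "r (P u) v = r u v" if "0 \<le> u" "0 \<le> v" for u v
  proof (cases "u = 0")
    case True
    then show ?thesis by (simp add: convolve_zero)
  next
    case False
    then have "P u \<noteq> 0" using convolve_eq_zero that by blast
    moreover have "x (P u) v = x u v" if "v \<noteq> 0"
      using stat[OF lt[OF \<open>0 \<le> u\<close> False] lt[OF \<open>0 \<le> v\<close> that]] by (rule antisym)
    ultimately show ?thesis using False unfolding r_def by simp
  qed
  then have "stationary_pricing \<phi> \<mu> r" unfolding stationary_pricing_def by simp
  ultimately show ?thesis by blast
qed

end

theorem theorem9:
  fixes G :: "('g, 'm) monoid_scheme"
    and \<mu> :: "'g pmf"
    and \<phi> :: "'g \<Rightarrow> 'v::ordered_real_vector \<Rightarrow> 'v"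
  assumes "amenable_group G"
    and "finitely_supported_distribution_on G \<mu>"
    and "symmetric_distribution G \<mu>"
    and "non_singular TYPE('v)"
    and "ordered_representation G \<phi>"
    and "order_bounded G \<phi>"
  shows "\<exists>r :: 'v \<Rightarrow> 'v \<Rightarrow> ennreal. vector_pricing r \<and> stationary_pricing \<phi> \<mu> r"
proof -
  interpret symmetric_walk_representation G \<mu> \<phi>
    using assms by unfold_locales
  show ?thesis using stationary_pricing_exists[OF assms(4)] .
qed

end
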